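(* For a space $X$, the following are equivalent: (a) $X$ is normal. (b) If $\Phi:X\to\mathscr{C}_{\mathbf c}(\mathbb{J}(2))$ is l.s.c., $\theta:X\to\mathscr{C}(\mathbb{J}(2))$ is u.s.c. and $\theta\leqslant\Phi$, then there exists a continuous mapping $\varphi:X\to\mathscr{C}_{\mathbf c}(\mathbb{J}(2))$ such that $\theta\leqslant\varphi\leqslant\Phi$. (c) If $\xi:X\to\mathbb{R}$ is upper semicontinuous, $\eta:X\to\mathbb{R}$ is lower semicontinuous and $\xi\leq\eta$, then there exists a continuous function $f:X\to\mathbb{R}$ such that $\xi\leq f\leq\eta$.
   Context: All spaces are infinite Hausdorff topological spaces. For a set $Y$, $2^Y$ denotes the family of all nonempty subsets of $Y$. For a space $Y$: $\mathscr{C}(Y)$ is the family of all nonempty compact subsets of $Y$, and $\mathscr{C}_{\mathbf c}(Y)$ is the family of its connected members. A mapping $\Phi:X\to 2^Y$ is l.s.c. if $\{x\in X:\Phi(x)\cap U\neq\varnothing\}$ is open for every open $U\subseteq Y$; u.s.c. if $\{x\in X:\Phi(x)\cap F\neq\varnothing\}$ is closed for every closed $F\subseteq Y$; continuous if it is both. For $\theta,\Phi:X\to 2^Y$, $\theta\leqslant\Phi$ means $\theta(x)\subseteq\Phi(x)$ for all $x\in X$. $\mathbb{J}(2)$ is the metrizable hedgehog with two spines: for a two-point set $\mathscr{A}$, it is the set $\{0\}\cup(0,1]\times\mathscr{A}$ with the metric $d(0,\langle s,\alpha\rangle)=s$, $d(\langle s,\alpha\rangle,\langle t,\beta\rangle)=|s-t|$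 if $\alpha=\beta$, and $=s+t$ if $\alpha\neq\beta$. It is isometric to $[-1,1]$ with the Euclidean distance. A function $\xi:X\to\mathbb{R}$ is lower (upper) semicontinuous if $\{x\in X:\xi(x)>r\}$ (respectively $\{x\in X:\xi(x)<r\}$) is open in $X$ for every $r\in\mathbb{R}$. For functions $\xi,\eta:X\to\mathbb{R}$, $\xi\leq\eta$ means $\xi(x)\leq\eta(x)$ for every $x\in X$. *)

theory Defs
  imports "HOL-Analysis.Analysis"
begin

text \<open>
  Spaces are abstract topologies. A mapping between spaces is a total function on the ambient
  type of which only the values on the carrier of the domain matter.
\<close>

definition nonempty_compacts :: "'b topology \<Rightarrow> 'b set set"
  where "nonempty_compacts Y = {K. compactin Y K \<and> K \<noteq> {}}"

definition nonempty_connected_compacts :: "'b topology \<Rightarrow> 'b set set"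
  where "nonempty_connected_compacts Y = {K \<in> nonempty_compacts Y. connectedin Y K}"

definition lsc_mapping :: "'a topology \<Rightarrow> 'b topology \<Rightarrow> ('a \<Rightarrow> 'b set) \<Rightarrow> bool"
  where "lsc_mapping X Y \<Phi> \<longleftrightarrow>
    (\<forall>U. openin Y U \<longrightarrow> openin X {x \<in> topspace X. \<Phi> x \<inter> U \<noteq> {}})"

definition usc_mapping :: "'a topology \<Rightarrow> 'b topology \<Rightarrow> ('a \<Rightarrow> 'b set) \<Rightarrow> bool"
  where "usc_mapping X Y \<Phi> \<longleftrightarrow>
    (\<forall>F. closedin Y F \<longrightarrow> closedin X {x \<in> topspace X. \<Phi> x \<inter> F \<noteq> {}})"

definition continuous_mapping :: "'a topology \<Rightarrow> 'b topology \<Rightarrow> ('a \<Rightarrow> 'b set) \<Rightarrow> bool"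
  where "continuous_mapping X Y \<Phi> \<longleftrightarrow> lsc_mapping X Y \<Phi> \<and> usc_mapping X Y \<Phi>"

definition submapping :: "'a topology \<Rightarrow> ('a \<Rightarrow> 'b set) \<Rightarrow> ('a \<Rightarrow> 'b set) \<Rightarrow> bool"
  where "submapping X \<theta> \<Phi> \<longleftrightarrow> (\<forall>x \<in> topspace X. \<theta> x \<subseteq> \<Phi> x)"

definition lower_semicontinuous :: "'a topology \<Rightarrow> ('a \<Rightarrow> real) \<Rightarrow> bool"
  where "lower_semicontinuous X \<xi> \<longleftrightarrow> (\<forall>r. openin X {x \<in> topspace X. \<xi> x > r})"

definition upper_semicontinuous :: "'a topology \<Rightarrow> ('a \<Rightarrow> real) \<Rightarrow> bool"
  where "upper_semicontinuous X \<xi> \<longleftrightarrow> (\<forall>r. openin X {x \<in> topspace X. \<xi> x < r})"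

datatype 'c hedgehog_point = Origin | Spine real 'c

definition hedgehog :: "'c set \<Rightarrow> 'c hedgehog_point set"
  where "hedgehog A = insert Origin {Spine s \<alpha> | s \<alpha>. 0 < s \<and> s \<le> 1 \<and> \<alpha> \<in> A}"

text \<open>
  On the hedgehog all parameters are positive. The absolute values are there only because
  the locale \<^locale>\<open>Metric_space\<close> wants a distance that is nonnegative on the whole type.
\<close>

fun hedgehog_dist :: "'c hedgehog_point \<Rightarrow> 'c hedgehog_point \<Rightarrow> real"
  where
    "hedgehog_dist Origin Origin = 0"
  | "hedgehog_dist Origin (Spine s \<alpha>) = \<bar>s\<bar>"
  | "hedgehog_dist (Spine s \<alpha>) Origin = \<bar>s\<bar>"
  | "hedgehog_dist (Spine s \<alpha>) (Spine t \<beta>) = (if \<alpha> = \<beta> then \<bar>s - t\<bar> else \<bar>s\<bar> + \<bar>t\<bar>)"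

lemma Metric_space_hedgehog: "Metric_space (hedgehog A) hedgehog_dist"
proof
  fix x y z :: "'a hedgehog_point"
  show "0 \<le> hedgehog_dist x y"
    by (cases x; cases y) auto
  show "hedgehog_dist x y = hedgehog_dist y x"
    by (cases x; cases y) auto
  show "hedgehog_dist x y = 0 \<longleftrightarrow> x = y" if "x \<in> hedgehog A" "y \<in> hedgehog A"
    using that by (cases x; cases y) (auto simp: hedgehog_def)
  show "hedgehog_dist x z \<le> hedgehog_dist x y + hedgehog_dist y z"
    by (cases x; cases y; cases z) auto
qed

definition hedgehog_space :: "'c set \<Rightarrow> 'c hedgehog_point topology"
  where "hedgehog_space A = Metric_space.mtopology (hedgehog A) hedgehog_dist"

lemma topspace_hedgehog_space [simp]: "topspace (hedgehog_space A) = hedgehog A"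
  by (simp add: hedgehog_space_def Metric_space.topspace_mtopology [OF Metric_space_hedgehog])

end

theory Submission
  imports Defs
begin

text \<open>
  Insertion of a continuous function is obtained in a normal space from a uniform limit: a
  scaled sum of Urysohn functions, one for each level of a fine grid, lies between \<open>\<xi> - \<epsilon>\<close> and
  \<open>\<eta> + \<epsilon>\<close>, and an approximation \<open>f\<close> of precision \<open>\<epsilon>\<close> is corrected by applying this to
  \<open>max \<xi> (f - \<epsilon>) \<le> min \<eta> (f + \<epsilon>)\<close>. Unbounded functions are reduced to bounded ones by \<open>arctan\<close>.

  Through the coordinate \<open>h\<close> that identifies the hedgehog with two spines with \<open>[-1, 1]\<close>, the
  mapping \<open>\<Phi>\<close> becomes interval-valued. Inserting continuous functions between the suprema of
  \<open>h\<close> over \<open>\<theta>\<close> and \<open>\<Phi>\<close>, and likewise for \<open>-h\<close>, gives the two ends of the interval-valued \<open>\<phi>\<close>.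
  Conversely, for disjoint closed sets \<open>S\<close> and \<open>T\<close>, take \<open>\<Phi>\<close> to be a point \<open>p\<close> on \<open>T\<close> and the
  whole space elsewhere, and \<open>\<theta>\<close> to be the whole space on \<open>S\<close> and \<open>p\<close> elsewhere: a continuous \<open>\<phi>\<close>
  in between separates \<open>S\<close> from \<open>T\<close>.
\<close>

section \<open>Operations on semicontinuous functions\<close>

lemma continuous_imp_upper_semicontinuous:
  assumes "continuous_map X euclideanreal f"
  shows "upper_semicontinuous X f"
  using assms by (simp add: upper_semicontinuous_def continuous_map_upper_lower_semicontinuous_lt)

lemma continuous_imp_lower_semicontinuous:
  assumes "continuous_map X euclideanreal f"
  shows "lower_semicontinuous X f"
  using assms by (simp add: lower_semicontinuous_def continuous_map_upper_lower_semicontinuous_lt)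

lemma upper_semicontinuous_max:
  assumes "upper_semicontinuous X f" "upper_semicontinuous X g"
  shows "upper_semicontinuous X (\<lambda>x. max (f x) (g x))"
proof -
  have "{x \<in> topspace X. max (f x) (g x) < r} =
      {x \<in> topspace X. f x < r} \<inter> {x \<in> topspace X. g x < r}" for r
    by auto
  with assms show ?thesis
    by (auto simp: upper_semicontinuous_def)
qed

lemma lower_semicontinuous_min:
  assumes "lower_semicontinuous X f" "lower_semicontinuous X g"
  shows "lower_semicontinuous X (\<lambda>x. min (f x) (g x))"
proof -
  have "{x \<in> topspace X. min (f x) (g x) > r} =
      {x \<in> topspace X. f x > r} \<inter> {x \<in> topspace X. g x > r}" for r
    by auto
  with assms show ?thesis
    by (auto simp: lower_semicontinuous_def)
qed

section \<open>Inserting a continuous function in a normal space\<close>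

text \<open>The Urysohn function \<open>u k\<close> vanishes where \<open>\<eta>\<close> is at most
  level \<open>k\<close> of a grid of mesh \<open>\<epsilon>\<close> starting at \<open>a\<close>,
  and equals 1 where \<open>\<xi>\<close> reaches level \<open>k + 1\<close>. Summing over
  \<open>k\<close> counts grid steps: every step completed below \<open>\<xi> x\<close> counts fully
  and every step starting at or above \<open>\<eta> x\<close> counts nothing, so rounding costs at
  most one mesh on either side.\<close>

lemma normal_space_approx_insertion:
  fixes \<epsilon> a b :: real
  assumes "normal_space X" "0 < \<epsilon>"
    and usc: "upper_semicontinuous X \<xi>" and lsc: "lower_semicontinuous X \<eta>"
    and ord: "\<And>x. x \<in> topspace X \<Longrightarrow> a \<le> \<xi> x \<and> \<xi> x \<le> \<eta> x \<and> \<eta> x \<le> b"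
  obtains f where "continuous_map X euclideanreal f"
    "\<And>x. x \<in> topspace X \<Longrightarrow> \<xi> x - \<epsilon> \<le> f x \<and> f x \<le> \<eta> x + \<epsilon>"
proof -
  \<comment> \<open>With \<open>N\<close> steps the grid covers all of \<open>[a, b]\<close>, so no
    level below \<open>\<xi> x\<close> is missing from the sum.\<close>
  define N where "N = nat \<lceil>(b - a) / \<epsilon>\<rceil>"
  have "\<exists>u. continuous_map X (top_of_set {0..1::real}) u \<and>
      (\<forall>x\<in>topspace X. (\<eta> x \<le> a + real k * \<epsilon> \<longrightarrow> u x = 0) \<and> (a + real (Suc k) * \<epsilon> \<le> \<xi> x \<longrightarrow> u x = 1))" for k
  proof -
    let ?S = "{x \<in> topspace X. \<eta> x \<le> a + real k * \<epsilon>}"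
    let ?T = "{x \<in> topspace X. a + real (Suc k) * \<epsilon> \<le> \<xi> x}"
    have "topspace X - ?S = {x \<in> topspace X. \<eta> x > a + real k * \<epsilon>}"
      "topspace X - ?T = {x \<in> topspace X. \<xi> x < a + real (Suc k) * \<epsilon>}"
      by auto
    then have "closedin X ?S" "closedin X ?T"
      using usc lsc unfolding closedin_def upper_semicontinuous_def lower_semicontinuous_def
      by auto
    moreover have "disjnt ?S ?T"
    proof -
      have "\<eta> x \<le> a + real k * \<epsilon> \<Longrightarrow> \<xi> x < a + real (Suc k) * \<epsilon>" if "x \<in> topspace X" for x
        using ord[OF that] \<open>0 < \<epsilon>\<close> by (simp add: algebra_simps)
      then show ?thesis
        by (fastforce simp: disjnt_iff)
    qed
    ultimately obtain u where u: "continuous_map X (top_of_set {0..1::real}) u"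
        "u ` ?S \<subseteq> {0}" "u ` ?T \<subseteq> {1}"
      using Urysohn_lemma[OF \<open>normal_space X\<close>, of ?S ?T 0 1] by auto
    then show ?thesis
      by blast
  qed
  then obtain u where u_cont: "\<And>k. continuous_map X (top_of_set {0..1::real}) (u k)"
    and u0: "\<And>k x. x \<in> topspace X \<Longrightarrow> \<eta> x \<le> a + real k * \<epsilon> \<Longrightarrow> u k x = 0"
    and u1: "\<And>k x. x \<in> topspace X \<Longrightarrow> a + real (Suc k) * \<epsilon> \<le> \<xi> x \<Longrightarrow> u k x = 1"
    by metis
  have u01: "0 \<le> u k x \<and> u k x \<le> 1" if "x \<in> topspace X" for k x
    using u_cont[of k] that by (auto simp: continuous_map_in_subtopology)
  define f where "f x = a + \<epsilon> * (\<Sum>k<N. u k x)" for x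
  show thesis
  proof
    show "continuous_map X euclideanreal f"
      unfolding f_def using u_cont
      by (intro continuous_map_add continuous_map_real_mult continuous_map_sum)
        (auto simp: continuous_map_in_subtopology)
    fix x
    assume x: "x \<in> topspace X"
    \<comment> \<open>\<open>m\<close> is the number of grid steps completed at height
      \<open>\<xi> x\<close>; the terms with \<open>k < m\<close> are all 1.\<close>
    define m where "m = nat \<lfloor>(\<xi> x - a) / \<epsilon>\<rfloor>"
    have pos: "0 \<le> (\<xi> x - a) / \<epsilon>" "0 \<le> (\<eta> x - a) / \<epsilon>"
      using ord[OF x] \<open>0 < \<epsilon>\<close> by auto
    then have m: "real m \<le> (\<xi> x - a) / \<epsilon>" "(\<xi> x - a) / \<epsilon> < real m + 1"
      unfolding m_def by linarith+
    have "(\<xi> x - a) / \<epsilon> \<le> (b - a) / \<epsilon>"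
      using ord[OF x] \<open>0 < \<epsilon>\<close> by (intro divide_right_mono) auto
    then have "real m \<le> real N"
      using m(1) unfolding N_def by linarith
    then have "m \<le> N" by simp
    have "u k x = 1" if "k < m" for k
    proof (rule u1[OF x])
      have "real (Suc k) \<le> (\<xi> x - a) / \<epsilon>"
        using that m(1) by linarith
      then show "a + real (Suc k) * \<epsilon> \<le> \<xi> x"
        using \<open>0 < \<epsilon>\<close> by (simp add: pos_le_divide_eq)
    qed
    then have "real m = (\<Sum>k<m. u k x)"
      by simp
    also have "\<dots> \<le> (\<Sum>k<N. u k x)"
      using \<open>m \<le> N\<close> u01[OF x] by (intro sum_mono2) auto
    finally have "(\<xi> x - a) / \<epsilon> - 1 \<le> (\<Sum>k<N. u k x)"
      using m(2) by linarith
    then have lo: "\<xi> x - \<epsilon> \<le> f x"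
      using \<open>0 < \<epsilon>\<close> by (simp add: f_def field_simps)
    \<comment> \<open>Level \<open>j\<close> is the first one at or above \<open>\<eta> x\<close>;
      from there on all terms vanish, and the earlier ones contribute at most 1 each.\<close>
    define j where "j = nat \<lceil>(\<eta> x - a) / \<epsilon>\<rceil>"
    have j: "(\<eta> x - a) / \<epsilon> \<le> real j" "real j \<le> (\<eta> x - a) / \<epsilon> + 1"
      using pos(2) unfolding j_def by linarith+
    have uj: "u k x = 0" if "j \<le> k" for k
    proof (rule u0[OF x])
      have "(\<eta> x - a) / \<epsilon> \<le> real k"
        using that j(1) by linarith
      then show "\<eta> x \<le> a + real k * \<epsilon>"
        using \<open>0 < \<epsilon>\<close> by (simp add: pos_divide_le_eq)
    qed
    have "(\<Sum>k<N. u k x) \<le> (\<Sum>k<N. if k < j then 1 else 0)"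
      using uj u01[OF x] by (intro sum_mono) auto
    also have "\<dots> = real (card {k. k < N \<and> k < j})"
      by (simp add: sum.If_cases Int_def)
    also have "\<dots> \<le> real j"
      using card_mono[of "{..<j}" "{k. k < N \<and> k < j}"] by auto
    finally have "(\<Sum>k<N. u k x) \<le> (\<eta> x - a) / \<epsilon> + 1"
      using j(2) by linarith
    then have "f x \<le> \<eta> x + \<epsilon>"
      using \<open>0 < \<epsilon>\<close> by (simp add: f_def field_simps)
    with lo show "\<xi> x - \<epsilon> \<le> f x \<and> f x \<le> \<eta> x + \<epsilon>" ..
  qed
qed

text \<open>Approximants of precision \<open>(1/2) ^ n\<close> are chosen one after another, each
  close to its predecessor. Consecutive differences are dominated by a geometric series, so the
  sequence is uniformly Cauchy; its limit is continuous and the errors disappear.\<close>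

lemma normal_space_bounded_insertion:
  fixes a b :: real
  assumes "normal_space X"
    and usc: "upper_semicontinuous X \<xi>" and lsc: "lower_semicontinuous X \<eta>"
    and ord: "\<And>x. x \<in> topspace X \<Longrightarrow> a \<le> \<xi> x \<and> \<xi> x \<le> \<eta> x \<and> \<eta> x \<le> b"
  obtains f where "continuous_map X euclideanreal f"
    "\<And>x. x \<in> topspace X \<Longrightarrow> \<xi> x \<le> f x \<and> f x \<le> \<eta> x"
proof -
  let ?e = "\<lambda>n. (1/2) ^ n :: real"
  let ?P = "\<lambda>n f. continuous_map X euclideanreal f \<and>
      (\<forall>x\<in>topspace X. \<xi> x - ?e n \<le> f x \<and> f x \<le> \<eta> x + ?e n)"
  have "\<exists>f. \<forall>n. ?P n (f n) \<and> (\<forall>x\<in>topspace X. \<bar>f (Suc n) x - f n x\<bar> \<le> 2 * ?e n)"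
  proof (rule dependent_nat_choice)
    show "\<exists>f. ?P 0 f"
      using normal_space_approx_insertion[OF \<open>normal_space X\<close> zero_less_one usc lsc ord]
      by (metis power_0)
    fix f n
    assume f: "?P n f"
    \<comment> \<open>Cutting both bounds to the band of radius \<open>?e n\<close> around
      \<open>f\<close> keeps them in order, because \<open>f\<close> already has precision
      \<open>?e n\<close>. Any \<open>g\<close> inserted between them up to
      \<open>?e (Suc n)\<close> is then within \<open>?e n + ?e (Suc n) \<le> 2 * ?e n\<close> of
      \<open>f\<close>.\<close>
    define \<xi>' where "\<xi>' x = max (\<xi> x) (f x - ?e n)" for x
    define \<eta>' where "\<eta>' x = min (\<eta> x) (f x + ?e n)" for x
    have e: "0 < ?e n" by simp
    have "upper_semicontinuous X \<xi>'" unfolding \<xi>'_def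
      using f by (intro upper_semicontinuous_max usc continuous_imp_upper_semicontinuous
          continuous_map_diff) auto
    moreover have "lower_semicontinuous X \<eta>'" unfolding \<eta>'_def
      using f by (intro lower_semicontinuous_min lsc continuous_imp_lower_semicontinuous
          continuous_map_add) auto
    moreover have "a \<le> \<xi>' x \<and> \<xi>' x \<le> \<eta>' x \<and> \<eta>' x \<le> b" if "x \<in> topspace X" for x
      using f ord that e unfolding \<xi>'_def \<eta>'_def by (smt (verit))
    ultimately obtain g where g: "continuous_map X euclideanreal g"
      "\<And>x. x \<in> topspace X \<Longrightarrow> \<xi>' x - ?e (Suc n) \<le> g x \<and> g x \<le> \<eta>' x + ?e (Suc n)"
      using normal_space_approx_insertion[OF \<open>normal_space X\<close>, of "?e (Suc n)" \<xi>' \<eta>' a b] by auto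
    have "(\<xi> x - ?e (Suc n) \<le> g x \<and> g x \<le> \<eta> x + ?e (Suc n)) \<and> \<bar>g x - f x\<bar> \<le> 2 * ?e n"
      if "x \<in> topspace X" for x
      using g(2)[OF that] e unfolding \<xi>'_def \<eta>'_def by auto
    with g(1) show "\<exists>g. ?P (Suc n) g \<and> (\<forall>x\<in>topspace X. \<bar>g x - f x\<bar> \<le> 2 * ?e n)"
      by blast
  qed
  then obtain f where cont: "\<And>n. continuous_map X euclideanreal (f n)"
    and f: "\<And>n x. x \<in> topspace X \<Longrightarrow> \<xi> x - ?e n \<le> f n x \<and> f n x \<le> \<eta> x + ?e n"
    and step: "\<And>n x. x \<in> topspace X \<Longrightarrow> \<bar>f (Suc n) x - f n x\<bar> \<le> 2 * ?e n"
    by blast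
  \<comment> \<open>The bound is the exact value of the sum of \<open>2 * ?e i\<close> for
    \<open>n \<le> i < n + k\<close>, which lets the induction close by arithmetic.\<close>
  have diff: "\<bar>f (n + k) x - f n x\<bar> \<le> 4 * ?e n - 4 * ?e (n + k)" if "x \<in> topspace X" for n k x
  proof (induction k)
    case (Suc k)
    then show ?case
      using step[OF that, of "n + k"] by simp
  qed simp
  have small: "\<exists>N. 4 * ?e N < \<epsilon>" if "0 < \<epsilon>" for \<epsilon> :: real
    using real_arch_pow_inv[of "\<epsilon>/4" "1/2"] that by (auto simp: field_simps)
  obtain g where g: "continuous_map X Met_TC.mtopology g"
    and lim: "\<And>\<epsilon>. 0 < \<epsilon> \<Longrightarrow> \<forall>\<^sub>F n in sequentially. \<forall>x\<in>topspace X. dist (f n x) (g x) < (\<epsilon>::real)"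
  proof (rule Met_TC.continuous_map_uniformly_Cauchy_limit)
    show "Met_TC.mcomplete TYPE(real)"
      by (simp add: complete_UNIV)
    show "\<forall>\<^sub>F n in sequentially. continuous_map X Met_TC.mtopology (f n)"
      using cont by simp
    show "\<exists>N. \<forall>m n x. N \<le> m \<longrightarrow> N \<le> n \<longrightarrow> x \<in> topspace X \<longrightarrow> dist (f m x) (f n x) < \<epsilon>"
      if \<epsilon>: "0 < \<epsilon>" for \<epsilon> :: real
    proof -
      obtain N where N: "4 * ?e N < \<epsilon> / 2"
        using small[of "\<epsilon>/2"] \<epsilon> by auto
      have "\<bar>f n x - f N x\<bar> < \<epsilon> / 2" if "N \<le> n" "x \<in> topspace X" for n x
      proof -
        have "\<bar>f n x - f N x\<bar> \<le> 4 * ?e N - 4 * ?e n"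
          using diff[OF that(2), of N "n - N"] that(1) by simp
        moreover have "0 < ?e n"
          by simp
        ultimately show ?thesis
          using N by linarith
      qed
      then have "dist (f m x) (f n x) < \<epsilon>" if "N \<le> m" "N \<le> n" "x \<in> topspace X" for m n x
        using that by (smt (verit) dist_real_def field_sum_of_halves)
      then show ?thesis
        by blast
    qed
  qed auto
  show thesis
  proof
    show "continuous_map X euclideanreal g"
      using g by simp
    fix x
    assume x: "x \<in> topspace X"
    have f_lim: "(\<lambda>n. f n x) \<longlonglongrightarrow> g x"
      unfolding tendsto_iff using lim x by (fastforce elim: eventually_mono)
    have e_lim: "?e \<longlonglongrightarrow> 0"
      by (rule LIMSEQ_realpow_zero) auto
    have "(\<lambda>n. f n x + ?e n) \<longlonglongrightarrow> g x" "(\<lambda>n. f n x - ?e n) \<longlonglongrightarrow> g x"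
      using tendsto_add[OF f_lim e_lim] tendsto_diff[OF f_lim e_lim] by simp_all
    moreover have "\<xi> x \<le> f n x + ?e n" "f n x - ?e n \<le> \<eta> x" for n
      using f[OF x, of n] by auto
    ultimately show "\<xi> x \<le> g x \<and> g x \<le> \<eta> x"
      by (meson LIMSEQ_le_const LIMSEQ_le_const2)
  qed
qed

text \<open>Since \<open>arctan\<close> is increasing, it preserves order and both kinds of
  semicontinuity while making the functions bounded; \<open>tan\<close> carries the inserted
  function back.\<close>

lemma normal_space_insertion:
  assumes "normal_space X"
    and usc: "upper_semicontinuous X \<xi>" and lsc: "lower_semicontinuous X \<eta>"
    and ord: "\<And>x. x \<in> topspace X \<Longrightarrow> \<xi> x \<le> \<eta> x"
  obtains f where "continuous_map X euclideanreal f"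
    "\<And>x. x \<in> topspace X \<Longrightarrow> \<xi> x \<le> f x \<and> f x \<le> \<eta> x"
proof -
  have "upper_semicontinuous X (\<lambda>x. arctan (\<xi> x))"
    unfolding upper_semicontinuous_def
  proof
    fix r :: real
    \<comment> \<open>A level outside the range of \<open>arctan\<close> yields the empty set or the
      whole space; a level inside it corresponds to the level \<open>tan r\<close> of
      \<open>\<xi>\<close>.\<close>
    consider "r \<le> - (pi/2)" | "pi/2 \<le> r" | "- (pi/2) < r" "r < pi/2" by linarith
    then show "openin X {x \<in> topspace X. arctan (\<xi> x) < r}"
    proof cases
      case 1
      then have "\<not> arctan y < r" for y
        using arctan_lbound[of y] by linarith
      then show ?thesis by simp
    next
      case 2
      then have "arctan y < r" for y
        using arctan_ubound[of y] by linarith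
      then show ?thesis by simp
    next
      case 3
      then have "arctan y < r \<longleftrightarrow> y < tan r" for y
        by (metis arctan_less_iff arctan_tan)
      then show ?thesis
        using usc by (simp add: upper_semicontinuous_def)
    qed
  qed
  moreover have "lower_semicontinuous X (\<lambda>x. arctan (\<eta> x))"
    unfolding lower_semicontinuous_def
  proof
    fix r :: real
    consider "r \<le> - (pi/2)" | "pi/2 \<le> r" | "- (pi/2) < r" "r < pi/2" by linarith
    then show "openin X {x \<in> topspace X. r < arctan (\<eta> x)}"
    proof cases
      case 1
      then have "r < arctan y" for y
        using arctan_lbound[of y] by linarith
      then show ?thesis by simp
    next
      case 2
      then have "\<not> r < arctan y" for y
        using arctan_ubound[of y] by linarith
      then show ?thesis by simp
    next
      case 3
      then have "r < arctan y \<longleftrightarrow> tan r < y" for y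
        by (metis arctan_less_iff arctan_tan)
      then show ?thesis
        using lsc by (simp add: lower_semicontinuous_def)
    qed
  qed
  moreover have "- (pi/2) \<le> arctan (\<xi> x) \<and> arctan (\<xi> x) \<le> arctan (\<eta> x) \<and> arctan (\<eta> x) \<le> pi/2"
    if "x \<in> topspace X" for x
    using ord[OF that] arctan_lbound[of "\<xi> x"] arctan_ubound[of "\<eta> x"] by (simp add: arctan_le_iff)
  ultimately obtain g where g: "continuous_map X euclideanreal g"
    "\<And>x. x \<in> topspace X \<Longrightarrow> arctan (\<xi> x) \<le> g x \<and> g x \<le> arctan (\<eta> x)"
    using normal_space_bounded_insertion[OF \<open>normal_space X\<close>,
        of "\<lambda>x. arctan (\<xi> x)" "\<lambda>x. arctan (\<eta> x)" "- (pi/2)" "pi/2"] by auto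
  \<comment> \<open>Strictness matters: \<open>g x\<close> lies between two values of
    \<open>arctan\<close>, so it stays in the open interval on which \<open>tan\<close> is
    continuous.\<close>
  have bound: "- (pi/2) < g x \<and> g x < pi/2" if "x \<in> topspace X" for x
    using g(2)[OF that] arctan_lbound[of "\<xi> x"] arctan_ubound[of "\<eta> x"] by linarith
  show thesis
  proof
    have "continuous_on {- (pi/2)<..<pi/2} (tan :: real \<Rightarrow> real)"
      by (intro continuous_on_tan continuous_on_id) (auto dest: cos_gt_zero_pi)
    then have "continuous_map (top_of_set {- (pi/2)<..<pi/2}) euclideanreal tan"
      by simp
    moreover have "continuous_map X (top_of_set {- (pi/2)<..<pi/2}) g"
      using g(1) bound by (auto simp: continuous_map_in_subtopology)
    ultimately show "continuous_map X euclideanreal (tan \<circ> g)"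
      using continuous_map_compose by blast
    fix x
    assume x: "x \<in> topspace X"
    have "arctan (\<xi> x) \<le> arctan (tan (g x)) \<and> arctan (tan (g x)) \<le> arctan (\<eta> x)"
      using g(2)[OF x] bound[OF x] by (simp add: arctan_tan)
    then show "\<xi> x \<le> (tan \<circ> g) x \<and> (tan \<circ> g) x \<le> \<eta> x"
      by (simp add: arctan_le_iff)
  qed
qed

section \<open>From insertion of functions to normality\<close>

text \<open>Insertion between the indicator of \<open>T\<close> and the indicator of the complement
  of \<open>S\<close> yields a continuous function that is 0 on \<open>S\<close> and 1 on
  \<open>T\<close>; cutting it at \<open>1/2\<close> separates the two sets.\<close>

lemma insertion_imp_normal_space:
  assumes ins: "\<And>\<xi> \<eta>. \<lbrakk>upper_semicontinuous X \<xi>; lower_semicontinuous X \<eta>; \<forall>x\<in>topspace X. \<xi> x \<le> \<eta> x\<rbrakk>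
      \<Longrightarrow> \<exists>f. continuous_map X euclideanreal f \<and> (\<forall>x\<in>topspace X. \<xi> x \<le> f x \<and> f x \<le> \<eta> x)"
  shows "normal_space X"
  unfolding normal_space_def
proof (intro allI impI)
  fix S T
  assume ST: "closedin X S \<and> closedin X T \<and> disjnt S T"
  define \<xi> where "\<xi> x = (if x \<in> T then 1 else 0 :: real)" for x
  define \<eta> where "\<eta> x = (if x \<in> S then 0 else 1 :: real)" for x
  have open_compl: "openin X (topspace X - S)" "openin X (topspace X - T)"
    using ST by auto
  have "{x \<in> topspace X. \<xi> x < r} = (if r \<le> 0 then {} else if r \<le> 1 then topspace X - T else topspace X)" for r
    by (auto simp: \<xi>_def)
  then have "upper_semicontinuous X \<xi>"
    using open_compl by (simp add: upper_semicontinuous_def)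
  moreover have "{x \<in> topspace X. \<eta> x > r} = (if r < 0 then topspace X else if r < 1 then topspace X - S else {})" for r
    by (auto simp: \<eta>_def)
  then have "lower_semicontinuous X \<eta>"
    using open_compl by (simp add: lower_semicontinuous_def)
  moreover have "\<forall>x\<in>topspace X. \<xi> x \<le> \<eta> x"
    using ST by (auto simp: \<xi>_def \<eta>_def disjnt_iff)
  ultimately obtain f where f: "continuous_map X euclideanreal f"
    "\<And>x. x \<in> topspace X \<Longrightarrow> \<xi> x \<le> f x \<and> f x \<le> \<eta> x"
    using ins[of \<xi> \<eta>] by blast
  show "\<exists>U V. openin X U \<and> openin X V \<and> S \<subseteq> U \<and> T \<subseteq> V \<and> disjnt U V"
  proof (intro exI conjI)
    show "openin X {x \<in> topspace X. f x < 1/2}" "openin X {x \<in> topspace X. f x > 1/2}"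
      using f(1) unfolding continuous_map_upper_lower_semicontinuous_lt by blast+
    show "S \<subseteq> {x \<in> topspace X. f x < 1/2}"
      using f(2) ST closedin_subset[of X S] by (force simp: \<eta>_def)
    show "T \<subseteq> {x \<in> topspace X. f x > 1/2}"
      using f(2) ST closedin_subset[of X T] by (force simp: \<xi>_def)
  qed (auto simp: disjnt_iff)
qed

section \<open>Suprema over compact-valued mappings\<close>

lemma compactin_attains_Sup:
  assumes "continuous_map Y euclideanreal h" "K \<in> nonempty_compacts Y"
  shows "Sup (h ` K) \<in> h ` K" "\<And>y. y \<in> K \<Longrightarrow> h y \<le> Sup (h ` K)"
proof -
  have "compact (h ` K)"
    using assms image_compactin[of Y K euclideanreal h] by (simp add: nonempty_compacts_def)
  moreover have "h ` K \<noteq> {}"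
    using assms by (simp add: nonempty_compacts_def)
  ultimately show "Sup (h ` K) \<in> h ` K" "\<And>y. y \<in> K \<Longrightarrow> h y \<le> Sup (h ` K)"
    by (auto intro!: closed_contains_Sup cSup_upper simp: compact_imp_closed compact_imp_bounded
        bounded_imp_bdd_above)
qed

text \<open>The supremum is attained, so it is below \<open>r\<close> exactly when
  \<open>\<theta> x\<close> misses the closed set where \<open>r \<le> h y\<close>.\<close>

lemma usc_mapping_imp_upper_semicontinuous_Sup:
  assumes h: "continuous_map Y euclideanreal h" and "\<theta> \<in> topspace X \<rightarrow> nonempty_compacts Y"
    and usc: "usc_mapping X Y \<theta>"
  shows "upper_semicontinuous X (\<lambda>x. Sup (h ` \<theta> x))"
  unfolding upper_semicontinuous_def
proof
  fix r
  let ?F = "{y \<in> topspace Y. r \<le> h y}"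
  have "Sup (h ` \<theta> x) < r \<longleftrightarrow> \<theta> x \<inter> ?F = {}" if "x \<in> topspace X" for x
  proof -
    have K: "\<theta> x \<in> nonempty_compacts Y"
      using assms that by auto
    then have "\<theta> x \<subseteq> topspace Y"
      by (simp add: nonempty_compacts_def compactin_subset_topspace)
    then show ?thesis
      using compactin_attains_Sup[OF h K] by fastforce
  qed
  then have "{x \<in> topspace X. Sup (h ` \<theta> x) < r} =
      topspace X - {x \<in> topspace X. \<theta> x \<inter> ?F \<noteq> {}}"
    by auto
  moreover have "closedin Y ?F"
    using h by (simp add: continuous_map_upper_lower_semicontinuous_le)
  then have "closedin X {x \<in> topspace X. \<theta> x \<inter> ?F \<noteq> {}}"
    using usc by (simp add: usc_mapping_def)
  ultimately show "openin X {x \<in> topspace X. Sup (h ` \<theta> x) < r}"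
    by (simp add: openin_diff)
qed

text \<open>The supremum exceeds \<open>r\<close> exactly when \<open>\<Phi> x\<close> meets the
  open set where \<open>r < h y\<close>.\<close>

lemma lsc_mapping_imp_lower_semicontinuous_Sup:
  assumes h: "continuous_map Y euclideanreal h" and "\<Phi> \<in> topspace X \<rightarrow> nonempty_compacts Y"
    and lsc: "lsc_mapping X Y \<Phi>"
  shows "lower_semicontinuous X (\<lambda>x. Sup (h ` \<Phi> x))"
  unfolding lower_semicontinuous_def
proof
  fix r
  let ?U = "{y \<in> topspace Y. r < h y}"
  have "r < Sup (h ` \<Phi> x) \<longleftrightarrow> \<Phi> x \<inter> ?U \<noteq> {}" if "x \<in> topspace X" for x
  proof -
    have K: "\<Phi> x \<in> nonempty_compacts Y"
      using assms that by auto
    then have "\<Phi> x \<subseteq> topspace Y"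
      by (simp add: nonempty_compacts_def compactin_subset_topspace)
    then show ?thesis
      using compactin_attains_Sup[OF h K] by fastforce
  qed
  then have "{x \<in> topspace X. r < Sup (h ` \<Phi> x)} = {x \<in> topspace X. \<Phi> x \<inter> ?U \<noteq> {}}"
    by auto
  moreover have "openin Y ?U"
    using h by (simp add: continuous_map_upper_lower_semicontinuous_lt)
  ultimately show "openin X {x \<in> topspace X. r < Sup (h ` \<Phi> x)}"
    using lsc by (simp add: lsc_mapping_def)
qed

text \<open>This supplies one end of the interval-valued mapping: with \<open>h\<close> the upper
  end, with \<open>- h\<close> the negative of the lower one. Witnesses in \<open>\<Phi> x\<close>
  replace the supremum so that connectedness can be applied to them.\<close>

lemma normal_space_scalar_insertion:
  assumes "normal_space X" and h: "continuous_map Y euclideanreal h"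
    and \<Phi>: "\<Phi> \<in> topspace X \<rightarrow> nonempty_compacts Y" "lsc_mapping X Y \<Phi>"
    and \<theta>: "\<theta> \<in> topspace X \<rightarrow> nonempty_compacts Y" "usc_mapping X Y \<theta>"
    and sub: "submapping X \<theta> \<Phi>"
  obtains f where "continuous_map X euclideanreal f"
    "\<And>x y. x \<in> topspace X \<Longrightarrow> y \<in> \<theta> x \<Longrightarrow> h y \<le> f x"
    "\<And>x. x \<in> topspace X \<Longrightarrow> \<exists>y\<in>\<Phi> x. f x \<le> h y"
proof -
  have "Sup (h ` \<theta> x) \<le> Sup (h ` \<Phi> x)" if "x \<in> topspace X" for x
  proof -
    have "\<theta> x \<in> nonempty_compacts Y" "\<Phi> x \<in> nonempty_compacts Y" "\<theta> x \<subseteq> \<Phi> x"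
      using \<theta> \<Phi> sub that by (auto simp: submapping_def)
    then obtain y where "y \<in> \<theta> x" "Sup (h ` \<theta> x) = h y"
      using compactin_attains_Sup(1)[OF h, of "\<theta> x"] by auto
    then show ?thesis
      using compactin_attains_Sup(2)[OF h \<open>\<Phi> x \<in> nonempty_compacts Y\<close>] \<open>\<theta> x \<subseteq> \<Phi> x\<close> by auto
  qed
  then obtain f where f: "continuous_map X euclideanreal f"
    "\<And>x. x \<in> topspace X \<Longrightarrow> Sup (h ` \<theta> x) \<le> f x \<and> f x \<le> Sup (h ` \<Phi> x)"
    using normal_space_insertion[OF \<open>normal_space X\<close>
        usc_mapping_imp_upper_semicontinuous_Sup[OF h \<theta>]
        lsc_mapping_imp_lower_semicontinuous_Sup[OF h \<Phi>]] by blast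
  show thesis
  proof
    show "h y \<le> f x" if "x \<in> topspace X" "y \<in> \<theta> x" for x y
      using compactin_attains_Sup(2)[OF h _ that(2)] \<theta> that f(2)[OF that(1)] by fastforce
    show "\<exists>y\<in>\<Phi> x. f x \<le> h y" if "x \<in> topspace X" for x
      using compactin_attains_Sup(1)[OF h, of "\<Phi> x"] \<Phi> that f(2)[OF that] by fastforce
  qed (fact f)
qed

section \<open>Continuity of interval-valued mappings and of their images\<close>

text \<open>Both halves rest on clamping: a point of one interval is moved to the nearest point of a
  neighbouring one, and it moves by less than \<open>e\<close> if the ends have not receded past it
  by \<open>e\<close> or more.\<close>

lemma continuous_mapping_interval:
  fixes f g :: "'a \<Rightarrow> real"
  assumes f: "continuous_map X euclideanreal f" and g: "continuous_map X euclideanreal g"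
    and le: "\<And>x. x \<in> topspace X \<Longrightarrow> f x \<le> g x"
  shows "continuous_mapping X euclideanreal (\<lambda>x. {f x..g x})"
proof -
  have nbhd: "openin X {x \<in> topspace X. f x < s \<and> t < g x}"
    "openin X {x \<in> topspace X. s < f x \<and> g x < t}" for s t
  proof -
    have "{x \<in> topspace X. f x < s \<and> t < g x} = {x \<in> topspace X. f x < s} \<inter> {x \<in> topspace X. t < g x}"
      "{x \<in> topspace X. s < f x \<and> g x < t} = {x \<in> topspace X. s < f x} \<inter> {x \<in> topspace X. g x < t}"
      by auto
    then show "openin X {x \<in> topspace X. f x < s \<and> t < g x}"
      "openin X {x \<in> topspace X. s < f x \<and> g x < t}"
      using f g by (simp_all add: continuous_map_upper_lower_semicontinuous_lt openin_Int)
  qed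
  have "openin X {x \<in> topspace X. {f x..g x} \<inter> U \<noteq> {}}" if "open U" for U
  proof (subst openin_subopen, rule ballI)
    fix x
    assume "x \<in> {x \<in> topspace X. {f x..g x} \<inter> U \<noteq> {}}"
    then obtain y where x: "x \<in> topspace X" and y: "y \<in> {f x..g x}" "y \<in> U"
      by blast
    obtain e where e: "0 < e" "ball y e \<subseteq> U"
      using \<open>open U\<close> y(2) open_contains_ball by blast
    let ?T = "{z \<in> topspace X. f z < y + e \<and> y - e < g z}"
    have "{f z..g z} \<inter> U \<noteq> {}" if "z \<in> ?T" for z
    proof -
      \<comment> \<open>This is the point of \<open>{f z..g z}\<close> nearest to
        \<open>y\<close>.\<close>
      have "max (f z) (min (g z) y) \<in> {f z..g z} \<inter> ball y e"
        using that le[of z] e(1) by (auto simp: dist_real_def max_def min_def)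
      with e(2) show ?thesis by blast
    qed
    with x y e(1) show "\<exists>T. openin X T \<and> x \<in> T \<and> T \<subseteq> {x \<in> topspace X. {f x..g x} \<inter> U \<noteq> {}}"
      by (intro exI[of _ ?T]) (use nbhd(1) in auto)
  qed
  moreover have "closedin X {x \<in> topspace X. {f x..g x} \<inter> F \<noteq> {}}" if "closed F" for F
  proof -
    have "openin X {x \<in> topspace X. {f x..g x} \<subseteq> - F}"
    proof (subst openin_subopen, rule ballI)
      fix x
      assume "x \<in> {x \<in> topspace X. {f x..g x} \<subseteq> - F}"
      then have x: "x \<in> topspace X" and sub: "{f x..g x} \<subseteq> - F"
        by auto
      \<comment> \<open>Compactness of the interval gives one radius \<open>e\<close> that works for
        all of its points.\<close>
      obtain e where e: "0 < e" "(\<Union>y\<in>{f x..g x}. ball y e) \<subseteq> - F"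
        using compact_subset_open_imp_ball_epsilon_subset[OF compact_Icc _ sub] \<open>closed F\<close>
        by auto
      let ?T = "{z \<in> topspace X. f x - e < f z \<and> g z < g x + e}"
      have "{f z..g z} \<subseteq> - F" if "z \<in> ?T" for z
      proof
        fix y
        assume "y \<in> {f z..g z}"
        then have "y \<in> ball (max (f x) (min (g x) y)) e"
          using that le[OF x] e(1) by (auto simp: dist_real_def max_def min_def)
        moreover have "max (f x) (min (g x) y) \<in> {f x..g x}"
          using le[OF x] by auto
        ultimately show "y \<in> - F"
          using e(2) by blast
      qed
      with x e(1) show "\<exists>T. openin X T \<and> x \<in> T \<and> T \<subseteq> {x \<in> topspace X. {f x..g x} \<subseteq> - F}"
        by (intro exI[of _ ?T]) (use nbhd(2) in auto)
    qed
    moreover have "topspace X - {x \<in> topspace X. {f x..g x} \<inter> F \<noteq> {}} =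
        {x \<in> topspace X. {f x..g x} \<subseteq> - F}"
      by auto
    ultimately show ?thesis
      by (simp add: closedin_def)
  qed
  ultimately show ?thesis
    by (simp add: continuous_mapping_def lsc_mapping_def usc_mapping_def)
qed

text \<open>A preimage under \<open>e\<close> is the trace on \<open>S\<close> of an open or closed
  set \<open>V\<close> of \<open>Y\<close>. As all values of \<open>\<Psi>\<close> lie in
  \<open>S\<close>, meeting the preimage is the same as meeting \<open>V\<close>. The set
  \<open>S\<close> is there because the inverse of the hedgehog coordinate is continuous only on an
  interval.\<close>

lemma continuous_mapping_image:
  assumes \<Psi>: "continuous_mapping X Y \<Psi>" and e: "continuous_map (subtopology Y S) Z e"
    and S: "\<And>x. x \<in> topspace X \<Longrightarrow> \<Psi> x \<subseteq> S \<inter> topspace Y"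
  shows "continuous_mapping X Z (\<lambda>x. e ` \<Psi> x)"
proof -
  have "openin X {x \<in> topspace X. e ` \<Psi> x \<inter> U \<noteq> {}}" if "openin Z U" for U
  proof -
    have "openin (subtopology Y S) {y \<in> topspace (subtopology Y S). e y \<in> U}"
      using e that by (rule openin_continuous_map_preimage)
    then obtain V where V: "openin Y V" "{y \<in> topspace (subtopology Y S). e y \<in> U} = V \<inter> S"
      by (auto simp: openin_subtopology)
    have "e ` \<Psi> x \<inter> U \<noteq> {} \<longleftrightarrow> \<Psi> x \<inter> V \<noteq> {}" if "x \<in> topspace X" for x
    proof -
      have "e y \<in> U \<longleftrightarrow> y \<in> V" if "y \<in> \<Psi> x" for y
        using V(2) S[OF \<open>x \<in> topspace X\<close>] that by auto
      then show ?thesis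
        by auto
    qed
    then have "{x \<in> topspace X. e ` \<Psi> x \<inter> U \<noteq> {}} = {x \<in> topspace X. \<Psi> x \<inter> V \<noteq> {}}"
      by blast
    then show ?thesis
      using \<Psi> V(1) by (simp add: continuous_mapping_def lsc_mapping_def)
  qed
  moreover have "closedin X {x \<in> topspace X. e ` \<Psi> x \<inter> F \<noteq> {}}" if "closedin Z F" for F
  proof -
    have "closedin (subtopology Y S) {y \<in> topspace (subtopology Y S). e y \<in> F}"
      using e that by (rule closedin_continuous_map_preimage)
    then obtain V where V: "closedin Y V" "{y \<in> topspace (subtopology Y S). e y \<in> F} = V \<inter> S"
      by (auto simp: closedin_subtopology)
    have "e ` \<Psi> x \<inter> F \<noteq> {} \<longleftrightarrow> \<Psi> x \<inter> V \<noteq> {}" if "x \<in> topspace X" for x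
    proof -
      have "e y \<in> F \<longleftrightarrow> y \<in> V" if "y \<in> \<Psi> x" for y
        using V(2) S[OF \<open>x \<in> topspace X\<close>] that by auto
      then show ?thesis
        by auto
    qed
    then have "{x \<in> topspace X. e ` \<Psi> x \<inter> F \<noteq> {}} = {x \<in> topspace X. \<Psi> x \<inter> V \<noteq> {}}"
      by blast
    then show ?thesis
      using \<Psi> V(1) by (simp add: continuous_mapping_def usc_mapping_def)
  qed
  ultimately show ?thesis
    by (simp add: continuous_mapping_def lsc_mapping_def usc_mapping_def)
qed

section \<open>Insertion of set-valued mappings and normality\<close>

text \<open>In the coordinate \<open>h\<close>, the segment from \<open>- f x\<close> to
  \<open>g x\<close> contains the image of \<open>\<theta> x\<close>. The image of
  \<open>\<Phi> x\<close> is connected and has points on or beyond both ends, so it contains the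
  segment. The inverse \<open>e\<close> transports the segment back to \<open>Y\<close>.\<close>

lemma normal_space_mapping_insertion:
  fixes a b :: real
  assumes "normal_space X" and he: "homeomorphic_maps Y (top_of_set {a..b}) h e"
    and \<Phi>: "\<Phi> \<in> topspace X \<rightarrow> nonempty_connected_compacts Y" "lsc_mapping X Y \<Phi>"
    and \<theta>: "\<theta> \<in> topspace X \<rightarrow> nonempty_compacts Y" "usc_mapping X Y \<theta>"
    and sub: "submapping X \<theta> \<Phi>"
  shows "\<exists>\<phi>. \<phi> \<in> topspace X \<rightarrow> nonempty_connected_compacts Y \<and> continuous_mapping X Y \<phi> \<and>
             submapping X \<theta> \<phi> \<and> submapping X \<phi> \<Phi>"
proof -
  have h: "continuous_map Y euclideanreal h" and e: "continuous_map (top_of_set {a..b}) Y e"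
    and hab: "\<And>y. y \<in> topspace Y \<Longrightarrow> h y \<in> {a..b}"
    and eh: "\<And>y. y \<in> topspace Y \<Longrightarrow> e (h y) = y"
    using he by (auto simp: homeomorphic_maps_def continuous_map_in_subtopology)
  have \<Phi>': "\<Phi> \<in> topspace X \<rightarrow> nonempty_compacts Y"
    using \<Phi> by (auto simp: nonempty_connected_compacts_def)
  have mh: "continuous_map Y euclideanreal (\<lambda>y. - h y)"
    using h by (rule continuous_map_minus)
  obtain g where g: "continuous_map X euclideanreal g"
    "\<And>x y. x \<in> topspace X \<Longrightarrow> y \<in> \<theta> x \<Longrightarrow> h y \<le> g x"
    "\<And>x. x \<in> topspace X \<Longrightarrow> \<exists>y\<in>\<Phi> x. g x \<le> h y"
    using normal_space_scalar_insertion[OF \<open>normal_space X\<close> h \<Phi>' \<Phi>(2) \<theta> sub] by blast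
  obtain f where f: "continuous_map X euclideanreal f"
    "\<And>x y. x \<in> topspace X \<Longrightarrow> y \<in> \<theta> x \<Longrightarrow> - h y \<le> f x"
    "\<And>x. x \<in> topspace X \<Longrightarrow> \<exists>y\<in>\<Phi> x. f x \<le> - h y"
    using normal_space_scalar_insertion[OF \<open>normal_space X\<close> mh \<Phi>' \<Phi>(2) \<theta> sub] by blast
  have \<theta>sub: "\<theta> x \<noteq> {}" "\<theta> x \<subseteq> topspace Y" if "x \<in> topspace X" for x
    using \<theta> that by (auto simp: nonempty_compacts_def dest: compactin_subset_topspace)
  \<comment> \<open>Any point \<open>y\<close> of the nonempty set \<open>\<theta> x\<close> gives
    \<open>- f x \<le> h y \<le> g x\<close>.\<close>
  have le: "- f x \<le> g x" if x: "x \<in> topspace X" for x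
    using \<theta>sub[OF x] f(2)[OF x] g(2)[OF x] by fastforce
  have \<Phi>sub: "\<Phi> x \<subseteq> topspace Y" if "x \<in> topspace X" for x
    using \<Phi>' that by (auto simp: nonempty_compacts_def dest: compactin_subset_topspace)
  have seg: "{- f x..g x} \<subseteq> h ` \<Phi> x" if x: "x \<in> topspace X" for x
  proof -
    have "connectedin Y (\<Phi> x)"
      using \<Phi> x by (auto simp: nonempty_connected_compacts_def)
    then have "connected (h ` \<Phi> x)"
      using connectedin_continuous_map_image[OF h] by simp
    moreover obtain y z where "y \<in> \<Phi> x" "h y \<le> - f x" "z \<in> \<Phi> x" "g x \<le> h z"
      using f(3)[OF x] g(3)[OF x] by fastforce
    ultimately show ?thesis
      using connected_contains_Icc[of "h ` \<Phi> x" "h y" "h z"] by fastforce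
  qed
  have segab: "{- f x..g x} \<subseteq> {a..b}" if x: "x \<in> topspace X" for x
    using seg[OF x] \<Phi>sub[OF x] hab by blast
  let ?\<phi> = "\<lambda>x. e ` {- f x..g x}"
  show ?thesis
  proof (intro exI conjI)
    show "?\<phi> \<in> topspace X \<rightarrow> nonempty_connected_compacts Y"
    proof
      fix x
      assume x: "x \<in> topspace X"
      have "compactin (top_of_set {a..b}) {- f x..g x}" "connectedin (top_of_set {a..b}) {- f x..g x}"
        using segab[OF x] by (auto simp: compactin_subtopology connectedin_subtopology)
      then have "compactin Y (?\<phi> x)" "connectedin Y (?\<phi> x)"
        using e by (blast intro: image_compactin connectedin_continuous_map_image)+
      with le[OF x] show "?\<phi> x \<in> nonempty_connected_compacts Y"
        by (simp add: nonempty_connected_compacts_def nonempty_compacts_def)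
    qed
    have "continuous_mapping X euclideanreal (\<lambda>x. {- f x..g x})"
      using f(1) g(1) le by (intro continuous_mapping_interval continuous_map_minus) auto
    then show "continuous_mapping X Y ?\<phi>"
      using e by (rule continuous_mapping_image) (use segab in auto)
    show "submapping X \<theta> ?\<phi>"
      unfolding submapping_def
    proof (intro ballI subsetI)
      fix x y
      assume "x \<in> topspace X" "y \<in> \<theta> x"
      then have "h y \<in> {- f x..g x}" "e (h y) = y"
        using f(2)[of x y] g(2)[of x y] \<theta>sub(2)[of x] eh by auto
      then show "y \<in> ?\<phi> x"
        by (metis imageI)
    qed
    show "submapping X ?\<phi> \<Phi>"
      unfolding submapping_def
    proof (intro ballI)
      fix x
      assume x: "x \<in> topspace X"
      have "?\<phi> x \<subseteq> e ` h ` \<Phi> x"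
        using seg[OF x] by blast
      also have "\<dots> \<subseteq> \<Phi> x"
        using \<Phi>sub[OF x] eh by auto
      finally show "?\<phi> x \<subseteq> \<Phi> x" .
    qed
  qed
qed

text \<open>Disjointness of \<open>S\<close> and \<open>T\<close> puts \<open>\<theta>\<close> below
  \<open>\<Phi>\<close>. A mapping \<open>\<phi>\<close> in between contains \<open>q\<close> in its
  values on \<open>S\<close> and has values inside \<open>{p}\<close> on \<open>T\<close>, and
  \<open>h\<close> tells these apart.\<close>

lemma mapping_insertion_imp_normal_space:
  assumes ins: "\<And>\<Phi> \<theta>. \<lbrakk>\<Phi> \<in> topspace X \<rightarrow> nonempty_connected_compacts Y; lsc_mapping X Y \<Phi>;
        \<theta> \<in> topspace X \<rightarrow> nonempty_compacts Y; usc_mapping X Y \<theta>; submapping X \<theta> \<Phi>\<rbrakk>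
      \<Longrightarrow> \<exists>\<phi>. continuous_mapping X Y \<phi> \<and> submapping X \<theta> \<phi> \<and> submapping X \<phi> \<Phi>"
    and Y: "compact_space Y" "connected_space Y"
    and h: "continuous_map Y euclideanreal h" "p \<in> topspace Y" "q \<in> topspace Y" "h p < h q"
  shows "normal_space X"
  unfolding normal_space_def
proof (intro allI impI)
  fix S T
  assume ST: "closedin X S \<and> closedin X T \<and> disjnt S T"
  define \<Phi> where "\<Phi> x = (if x \<in> T then {p} else topspace Y)" for x
  define \<theta> where "\<theta> x = (if x \<in> S then topspace Y else {p})" for x
  have whole: "topspace Y \<in> nonempty_connected_compacts Y"
    using Y h(2) by (auto simp: nonempty_connected_compacts_def nonempty_compacts_def
        compact_space_def connectedin_topspace)
  have single: "{p} \<in> nonempty_connected_compacts Y"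
    using h(2) by (auto simp: nonempty_connected_compacts_def nonempty_compacts_def)
  have "\<Phi> \<in> topspace X \<rightarrow> nonempty_connected_compacts Y"
    "\<theta> \<in> topspace X \<rightarrow> nonempty_compacts Y"
    using whole single by (auto simp: \<Phi>_def \<theta>_def nonempty_connected_compacts_def)
  moreover have "lsc_mapping X Y \<Phi>"
    unfolding lsc_mapping_def
  proof (intro allI impI)
    fix U
    assume "openin Y U"
    \<comment> \<open>Every value contains \<open>p\<close>; a nonempty \<open>U\<close> without
      \<open>p\<close> is met exactly where the value is the whole space.\<close>
    then have "{x \<in> topspace X. \<Phi> x \<inter> U \<noteq> {}} =
        (if p \<in> U then topspace X else if U = {} then {} else topspace X - T)"
      using h(2) openin_subset[of Y U] by (auto simp: \<Phi>_def)
    then show "openin X {x \<in> topspace X. \<Phi> x \<inter> U \<noteq> {}}"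
      using ST by auto
  qed
  moreover have "usc_mapping X Y \<theta>"
    unfolding usc_mapping_def
  proof (intro allI impI)
    fix F
    assume "closedin Y F"
    then have "{x \<in> topspace X. \<theta> x \<inter> F \<noteq> {}} =
        (if p \<in> F then topspace X else if F = {} then {} else S)"
      using h(2) closedin_subset[of Y F] closedin_subset[of X S] ST by (auto simp: \<theta>_def)
    then show "closedin X {x \<in> topspace X. \<theta> x \<inter> F \<noteq> {}}"
      using ST by auto
  qed
  moreover have "submapping X \<theta> \<Phi>"
    using ST h(2) by (auto simp: submapping_def \<theta>_def \<Phi>_def disjnt_iff)
  ultimately obtain \<phi> where \<phi>: "continuous_mapping X Y \<phi>" "submapping X \<theta> \<phi>" "submapping X \<phi> \<Phi>"
    using ins[of \<Phi> \<theta>] by blast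
  obtain r where r: "h p < r" "r < h q"
    using dense[OF h(4)] by blast
  \<comment> \<open>Lower semicontinuity needs the strict inequality and upper semicontinuity the
    weak one. Since \<open>?U \<subseteq> ?V\<close>, the open set \<open>?U\<close> is disjoint
    from the open complement of \<open>?V\<close>.\<close>
  let ?U = "{x \<in> topspace X. \<phi> x \<inter> {y \<in> topspace Y. r < h y} \<noteq> {}}"
  let ?V = "{x \<in> topspace X. \<phi> x \<inter> {y \<in> topspace Y. r \<le> h y} \<noteq> {}}"
  show "\<exists>U V. openin X U \<and> openin X V \<and> S \<subseteq> U \<and> T \<subseteq> V \<and> disjnt U V"
  proof (intro exI conjI)
    show "openin X ?U"
      using \<phi>(1) h(1) by (simp add: continuous_mapping_def lsc_mapping_def
          continuous_map_upper_lower_semicontinuous_lt)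
    have "closedin X ?V"
      using \<phi>(1) h(1) by (simp add: continuous_mapping_def usc_mapping_def
          continuous_map_upper_lower_semicontinuous_le)
    then show "openin X (topspace X - ?V)"
      by blast
    show "S \<subseteq> ?U"
    proof
      fix x
      assume "x \<in> S"
      moreover have "x \<in> topspace X"
        using \<open>x \<in> S\<close> ST closedin_subset by blast
      ultimately have "q \<in> \<theta> x"
        using h(3) by (simp add: \<theta>_def)
      then have "q \<in> \<phi> x"
        using \<phi>(2) \<open>x \<in> topspace X\<close> by (auto simp: submapping_def)
      with \<open>x \<in> topspace X\<close> h(3) r show "x \<in> ?U"
        by blast
    qed
    show "T \<subseteq> topspace X - ?V"
    proof
      fix x
      assume "x \<in> T"
      moreover have "x \<in> topspace X"
        using \<open>x \<in> T\<close> ST closedin_subset by blast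
      ultimately have "\<Phi> x = {p}" "\<phi> x \<subseteq> \<Phi> x"
        using \<phi>(3) by (simp add: \<Phi>_def, simp add: submapping_def)
      then have "\<phi> x \<subseteq> {p}"
        by simp
      with \<open>x \<in> topspace X\<close> r show "x \<in> topspace X - ?V"
        by auto
    qed
  qed (auto simp: disjnt_iff)
qed

section \<open>The hedgehog with two spines as an interval\<close>

text \<open>On the hedgehog this is the signed distance from \<open>Origin\<close>, positive on the
  spine \<open>\<alpha>\<close>. All other labels share the negative side, which is faithful when
  there are exactly two spines.\<close>

fun spine_coordinate :: "'c \<Rightarrow> 'c hedgehog_point \<Rightarrow> real"
  where
    "spine_coordinate \<alpha> Origin = 0"
  | "spine_coordinate \<alpha> (Spine s \<beta>) = (if \<beta> = \<alpha> then s else - s)"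

text \<open>The coordinate is an isometry onto \<open>[-1, 1]\<close>: for points on different
  spines, \<open>s + t\<close> is the distance from \<open>s\<close> to \<open>- t\<close>.\<close>

lemma homeomorphic_map_hedgehog_two:
  assumes "\<alpha> \<noteq> \<beta>"
  shows "homeomorphic_map (hedgehog_space {\<alpha>, \<beta>}) (top_of_set {-1..1}) (spine_coordinate \<alpha>)"
proof -
  \<comment> \<open>This identifies the metric topology of the interval with its subspace
    topology.\<close>
  interpret S: Submetric UNIV dist "{-1..1::real}"
    by unfold_locales auto
  interpret Metric_space12 "hedgehog {\<alpha>, \<beta>}" hedgehog_dist "{-1..1::real}" dist
    by (intro Metric_space12.intro Metric_space_hedgehog S.sub.Metric_space_axioms)
  have "spine_coordinate \<alpha> ` hedgehog {\<alpha>, \<beta>} = {-1..1}"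
  proof
    show "spine_coordinate \<alpha> ` hedgehog {\<alpha>, \<beta>} \<subseteq> {-1..1}"
      by (auto simp: hedgehog_def)
    show "{-1..1} \<subseteq> spine_coordinate \<alpha> ` hedgehog {\<alpha>, \<beta>}"
    proof
      fix t :: real
      assume t: "t \<in> {-1..1}"
      let ?y = "if t = 0 then Origin else if 0 < t then Spine t \<alpha> else Spine (- t) \<beta>"
      have "spine_coordinate \<alpha> ?y = t" "?y \<in> hedgehog {\<alpha>, \<beta>}"
        using t assms by (auto simp: hedgehog_def)
      then show "t \<in> spine_coordinate \<alpha> ` hedgehog {\<alpha>, \<beta>}"
        by (metis imageI)
    qed
  qed
  moreover have "dist (spine_coordinate \<alpha> x) (spine_coordinate \<alpha> y) = hedgehog_dist x y"
    if "x \<in> hedgehog {\<alpha>, \<beta>}" "y \<in> hedgehog {\<alpha>, \<beta>}" for x y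
    using that assms by (cases x; cases y) (auto simp: hedgehog_def dist_real_def)
  ultimately have "homeomorphic_map M1.mtopology S.sub.mtopology (spine_coordinate \<alpha>)"
    by (intro isometry_imp_homeomorphic_map) auto
  then show ?thesis
    by (simp add: hedgehog_space_def S.mtopology_submetric)
qed

theorem lemma5p2:
  fixes X :: "'a topology" and A :: "'c set"
  assumes "Hausdorff_space X" and "infinite (topspace X)"
    and "card A = 2"
  defines "J2 \<equiv> hedgehog_space A"
  defines "a \<equiv> normal_space X"
    and "b \<equiv> (\<forall>\<Phi> \<theta>.
        \<Phi> \<in> topspace X \<rightarrow> nonempty_connected_compacts J2 \<and> lsc_mapping X J2 \<Phi> \<and>
        \<theta> \<in> topspace X \<rightarrow> nonempty_compacts J2 \<and> usc_mapping X J2 \<theta> \<and>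
        submapping X \<theta> \<Phi> \<longrightarrow>
        (\<exists>\<phi>. \<phi> \<in> topspace X \<rightarrow> nonempty_connected_compacts J2 \<and> continuous_mapping X J2 \<phi> \<and>
             submapping X \<theta> \<phi> \<and> submapping X \<phi> \<Phi>))"
    and "c \<equiv> (\<forall>\<xi> \<eta>.
        upper_semicontinuous X \<xi> \<and> lower_semicontinuous X \<eta> \<and>
        (\<forall>x \<in> topspace X. \<xi> x \<le> \<eta> x) \<longrightarrow>
        (\<exists>f. continuous_map X euclideanreal f \<and>
             (\<forall>x \<in> topspace X. \<xi> x \<le> f x \<and> f x \<le> \<eta> x)))"
  shows "(a \<longleftrightarrow> b) \<and> (b \<longleftrightarrow> c)"
proof -
  obtain \<alpha> \<beta> where A: "A = {\<alpha>, \<beta>}" "\<alpha> \<noteq> \<beta>"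
    using \<open>card A = 2\<close> by (auto simp: card_2_iff)
  let ?h = "spine_coordinate \<alpha>"
  obtain e where he: "homeomorphic_maps J2 (top_of_set {-1..1}) ?h e"
    using homeomorphic_map_hedgehog_two[OF A(2)] by (auto simp: J2_def A(1) homeomorphic_map_maps)
  then have J2: "J2 homeomorphic_space top_of_set {-1..1::real}"
    by (auto simp: homeomorphic_space_def)
  \<comment> \<open>The points to be told apart are \<open>Origin\<close> and the tip of the spine
    \<open>\<alpha>\<close>, with coordinates 0 and 1.\<close>
  have "a" if "b"
    unfolding a_def
  proof (rule mapping_insertion_imp_normal_space)
    show "compact_space J2" "connected_space J2"
      using homeomorphic_compact_space[OF J2] homeomorphic_connected_space[OF J2]
      by (simp_all add: compact_space_subtopology connected_space_subtopology)
    show "continuous_map J2 euclideanreal ?h"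
      using he by (auto simp: homeomorphic_maps_def continuous_map_in_subtopology)
    show "Origin \<in> topspace J2" "Spine 1 \<alpha> \<in> topspace J2" "?h Origin < ?h (Spine 1 \<alpha>)"
      by (auto simp: J2_def A hedgehog_def)
  qed (use that in \<open>unfold b_def, blast\<close>)
  moreover have "b" if "a"
    using that normal_space_mapping_insertion[OF _ he] unfolding a_def b_def by blast
  moreover have "c" if "a"
    using that normal_space_insertion[of X] unfolding a_def c_def by metis
  moreover have "a" if "c"
    using that insertion_imp_normal_space[of X] unfolding a_def c_def by blast
  ultimately show ?thesis
    by blast
qed

end
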